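(* Let $n\ge1$. The set $S_n$ listed in Co-Reflected Gray Code order $\prec_c$ is a $3$-adjacent Gray code: consecutive sequences differ in at most $3$ positions, and these positions are adjacent.
   Context: $S_n$ (staircase words) is the set of sequences $s_1\ldots s_n$ of non-negative integers with $s_1=0$ and $0\le s_{k+1}\le s_k+1$ for $1\le k<n$. Co-Reflected Gray Code order: $s\prec_c t$ if, with $k$ the rightmost position where $s$ and $t$ differ, either $\sum_{i=k+1}^n s_i+(n-k)$ is even and $s_k>t_k$, or it is odd and $s_k<t_k$. A $d$-adjacent Gray code is a list in which consecutive sequences have Hamming distance at most $d$ and the positions where they differ are adjacent. *)

theory Defs
  imports Main
begin

text \<open>
  Sequences are lists, so positions are counted from 0: the entry $s_k$ with
  $1 \le k \le n$ is \<open>s ! (k - 1)\<close>.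
\<close>

definition staircase_words :: "nat \<Rightarrow> nat list set" where
  "staircase_words n =
     {s. length s = n \<and> (0 < n \<longrightarrow> s ! 0 = 0) \<and>
         (\<forall>k. Suc k < n \<longrightarrow> s ! Suc k \<le> s ! k + 1)}"

definition diff_positions :: "'a list \<Rightarrow> 'a list \<Rightarrow> nat set" where
  "diff_positions s t = {i. i < length s \<and> s ! i \<noteq> t ! i}"

definition hamming_dist :: "'a list \<Rightarrow> 'a list \<Rightarrow> nat" where
  "hamming_dist s t = card (diff_positions s t)"

text \<open>
  Below, \<open>k\<close> is the 0-based rightmost position of difference, so the number
  of positions to its right is \<open>length s - Suc k\<close>. As \<open>s\<close> and \<open>t\<close> agree there,
  it does not matter which of them supplies the parity.
\<close>

definition coreflected_less :: "nat list \<Rightarrow> nat list \<Rightarrow> bool" where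
  "coreflected_less s t \<longleftrightarrow>
     length s = length t \<and>
     (\<exists>k < length s. s ! k \<noteq> t ! k \<and> (\<forall>i. k < i \<and> i < length s \<longrightarrow> s ! i = t ! i) \<and>
        (let p = (\<Sum>i = Suc k..<length s. s ! i) + (length s - Suc k)
         in even p \<and> s ! k > t ! k \<or> odd p \<and> s ! k < t ! k))"

definition listed_in_order :: "('a \<Rightarrow> 'a \<Rightarrow> bool) \<Rightarrow> 'a set \<Rightarrow> 'a list \<Rightarrow> bool" where
  "listed_in_order R A L \<longleftrightarrow> set L = A \<and> distinct L \<and> sorted_wrt R L"

text \<open>Positions are adjacent when they form an interval of consecutive indices.\<close>

definition adjacent_gray_code :: "nat \<Rightarrow> 'a list list \<Rightarrow> bool" where
  "adjacent_gray_code d L \<longleftrightarrow>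
     (\<forall>j. Suc j < length L \<longrightarrow>
        hamming_dist (L ! j) (L ! Suc j) \<le> d \<and>
        (\<exists>a b. diff_positions (L ! j) (L ! Suc j) = {a..<b}))"

end

theory Submission
  imports Defs
begin

text \<open>
  Fix a suffix \<open>s\<^sub>k, s\<^sub>k\<^sub>+\<^sub>1, \<dots>\<close> of a staircase word. The word with that suffix that is extreme (first
  or last) in the order is built from right to left by taking the largest or the smallest
  admissible entry. Once the largest entry is taken, everything to its left is forced to be
  \<open>0, 1, 2, \<dots>\<close>; and by parity the smallest entry is taken at most twice in a row. So the extreme word
  is \<open>0, 1, 2, \<dots>\<close> except possibly at the two positions before the suffix. When \<open>s\<close> and \<open>t\<close> are
  consecutive and \<open>k\<close> is their rightmost difference, \<open>s\<^sub>k\<close> and \<open>t\<^sub>k\<close> differ by 1, \<open>s\<close> is the last word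
  with its suffix and \<open>t\<close> the first with its own; the change of parity at \<open>k\<close> cancels the exchange of
  first and last, so both words have the same shape.
\<close>

section \<open>Listing a finite set along a strict total order\<close>

text \<open>Induction on the set: a new element goes between the elements below it and the others,
  which lie above it by totality.\<close>

lemma listed_in_order_exists:
  assumes "finite A" and "transp_on A R" and "totalp_on A R"
  shows "\<exists>L. listed_in_order R A L"
  using assms
proof (induction A rule: finite_induct)
  case empty
  show ?case by (rule exI[of _ "[]"]) (simp add: listed_in_order_def)
next
  case (insert x A)
  have "transp_on A R" "totalp_on A R"
    using insert.prems by (auto intro: transp_on_subset totalp_on_subset)
  then obtain L where L: "set L = A" "distinct L" "sorted_wrt R L"
    using insert.IH by (auto simp: listed_in_order_def)
  have tot: "R x y \<or> R y x" if "y \<in> A" for y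
    using insert.prems(2) insert.hyps(2) that by (auto simp: totalp_on_def)
  have tr: "R a c" if "R a b" "R b c" "a \<in> insert x A" "b \<in> insert x A" "c \<in> insert x A" for a b c
    using insert.prems(1) that unfolding transp_on_def by blast
  let ?L = "filter (\<lambda>y. R y x) L @ x # filter (\<lambda>y. \<not> R y x) L"
  have "set ?L = insert x A" "distinct ?L"
    using L insert.hyps(2) by auto
  moreover have "sorted_wrt R ?L"
  proof -
    have "R x b" if "b \<in> A" "\<not> R b x" for b using tot that by blast
    moreover from this have "R a b" if "a \<in> A" "R a x" "b \<in> A" "\<not> R b x" for a b
      using tr[of a x b] that by blast
    ultimately show ?thesis using L by (simp add: sorted_wrt_append sorted_wrt_filter)
  qed
  ultimately show ?case unfolding listed_in_order_def by blast
qed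

lemma sorted_wrt_set_unique:
  assumes "asymp R" "sorted_wrt R xs" "sorted_wrt R ys" "distinct xs" "distinct ys" "set xs = set ys"
  shows "xs = ys"
  using assms(2-)
proof (induction xs arbitrary: ys)
  case Nil
  then show ?case by simp
next
  case (Cons x xs)
  then obtain y ys' where ys: "ys = y # ys'" by (cases ys) auto
  have "x = y"
  proof (rule ccontr)
    assume "x \<noteq> y"
    moreover have "x \<in> set (y # ys')" "y \<in> set (x # xs)"
      using Cons.prems(5) ys by auto
    ultimately show False
      using Cons.prems(1,2) ys asympD[OF assms(1), of x y] by auto
  qed
  moreover from this have "set xs = set ys'"
    using Cons.prems ys by (auto simp: insert_ident)
  ultimately show ?case using Cons ys by simp
qed

text \<open>Supplies \<open>no_between\<close> for neighbours in the listing: a candidate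
  \<open>u\<close> is itself an entry of the list, so its index would have to lie strictly between
  \<open>j\<close> and \<open>Suc j\<close>.\<close>

lemma sorted_wrt_no_element_between:
  assumes "asymp R" "sorted_wrt R L" "Suc j < length L"
    "u \<in> set L" "R (L ! j) u"
  shows "\<not> R u (L ! Suc j)"
proof
  assume *: "R u (L ! Suc j)"
  obtain i where i: "i < length L" "u = L ! i" using assms(4) by (auto simp: in_set_conv_nth)
  have mono: "R (L ! a) (L ! b)" if "a < b" "b < length L" for a b
    using assms(2) that by (auto simp: sorted_wrt_iff_nth_less)
  have asym: "\<not> R b a" if "R a b" for a b
    using assms(1) that by (rule asympD)
  consider "i < j" | "i = j" | "i = Suc j" | "Suc j < i" by linarith
  then show False
  proof cases
    case 1
    then show False using mono[of i j] asym[OF assms(5)] i assms(3) by simp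
  next
    case 2
    then show False using asym[OF assms(5)] assms(5) i by simp
  next
    case 3
    then show False using asym[OF *] * i by simp
  next
    case 4
    then show False using mono[of "Suc j" i] asym[OF *] i by simp
  qed
qed

section \<open>The order\<close>

text \<open>Each entry counts as \<open>s ! i + 1\<close>, so \<open>tail_weight s (Suc k)\<close>
  is the number whose parity the order consults at \<open>k\<close>. An even entry flips this
  parity, an odd one keeps it.\<close>

definition tail_weight :: "nat list \<Rightarrow> nat \<Rightarrow> nat" where
  "tail_weight s k = (\<Sum>i = k..<length s. s ! i) + (length s - k)"

lemma tail_weight_Suc:
  "k < length s \<Longrightarrow> tail_weight s k = s ! k + 1 + tail_weight s (Suc k)"
  by (simp add: tail_weight_def sum.atLeast_Suc_lessThan)

lemma tail_weight_cong:
  assumes "length s = length t" "\<And>i. k \<le> i \<Longrightarrow> i < length s \<Longrightarrow> s ! i = t ! i"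
  shows "tail_weight s k = tail_weight t k"
  unfolding tail_weight_def using assms by (auto intro: sum.cong)

definition less_at :: "nat \<Rightarrow> nat list \<Rightarrow> nat list \<Rightarrow> bool" where
  "less_at k s t \<longleftrightarrow> length s = length t \<and> k < length s \<and>
     (\<forall>i. k < i \<and> i < length s \<longrightarrow> s ! i = t ! i) \<and>
     (if odd (tail_weight s (Suc k)) then s ! k < t ! k else t ! k < s ! k)"

lemma coreflected_less_iff: "coreflected_less s t \<longleftrightarrow> (\<exists>k. less_at k s t)"
  unfolding coreflected_less_def less_at_def Let_def tail_weight_def[symmetric]
  by (auto split: if_splits)

lemma less_at_tail_weight:
  "less_at k s t \<Longrightarrow> tail_weight s (Suc k) = tail_weight t (Suc k)"
  by (rule tail_weight_cong) (auto simp: less_at_def)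

text \<open>The right one of the two deciding positions decides: beyond it all three words agree and
  share their weight. If the positions coincide, both comparisons have the same direction.\<close>

lemma less_at_trans:
  assumes "less_at k s t" "less_at l t u"
  shows "less_at (max k l) s u"
proof -
  note w = less_at_tail_weight[OF assms(1)] less_at_tail_weight[OF assms(2)]
  consider "k < l" | "k = l" | "l < k" by linarith
  then show ?thesis
  proof cases
    case 1
    then have "tail_weight s (Suc l) = tail_weight t (Suc l)"
      using assms by (intro tail_weight_cong) (auto simp: less_at_def)
    then show ?thesis using 1 assms by (auto simp: less_at_def max_def)
  next
    case 2
    then show ?thesis using assms w by (auto simp: less_at_def split: if_splits)
  next
    case 3
    then show ?thesis using assms w by (auto simp: less_at_def max_def)
  qed
qed

lemma not_less_at_refl: "\<not> less_at k s s"
  by (simp add: less_at_def)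

lemma transp_coreflected_less: "transp coreflected_less"
  by (rule transpI) (auto simp: coreflected_less_iff dest: less_at_trans)

lemma asymp_coreflected_less: "asymp coreflected_less"
  by (rule asympI) (auto simp: coreflected_less_iff not_less_at_refl dest: less_at_trans)

lemma coreflected_less_total:
  assumes "length s = length t" "s \<noteq> t"
  shows "coreflected_less s t \<or> coreflected_less t s"
proof -
  let ?D = "{i. i < length s \<and> s ! i \<noteq> t ! i}"
  have ne: "?D \<noteq> {}" using assms by (auto simp: list_eq_iff_nth_eq)
  have fin: "finite ?D" by simp
  define k where "k = Max ?D"
  have k: "k < length s" "s ! k \<noteq> t ! k" using Max_in[OF fin ne] by (auto simp: k_def)
  have above: "s ! i = t ! i" if "k < i" "i < length s" for i
  proof (rule ccontr)
    assume "s ! i \<noteq> t ! i"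
    then have "i \<le> k" using that(2) unfolding k_def by (intro Max_ge[OF fin]) simp
    then show False using that(1) by simp
  qed
  have "tail_weight s (Suc k) = tail_weight t (Suc k)"
    using assms above by (intro tail_weight_cong) auto
  then have "less_at k s t \<or> less_at k t s"
    using k above assms by (auto simp: less_at_def)
  then show ?thesis by (auto simp: coreflected_less_iff)
qed

section \<open>Staircase words\<close>

lemma staircase_length: "s \<in> staircase_words n \<Longrightarrow> length s = n"
  by (simp add: staircase_words_def)

lemma staircase_step: "s \<in> staircase_words n \<Longrightarrow> Suc k < n \<Longrightarrow> s ! Suc k \<le> s ! k + 1"
  by (simp add: staircase_words_def)

lemma staircase_nth_le: "s \<in> staircase_words n \<Longrightarrow> i < n \<Longrightarrow> s ! i \<le> i"
proof (induction i)
  case 0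
  then show ?case by (simp add: staircase_words_def)
next
  case (Suc i)
  then show ?case using staircase_step[of s n i] by simp
qed

lemma finite_staircase_words: "finite (staircase_words n)"
proof (rule finite_subset)
  show "staircase_words n \<subseteq> {s. set s \<subseteq> {..n} \<and> length s = n}"
    using staircase_nth_le by (fastforce simp: staircase_length in_set_conv_nth)
qed (simp add: finite_lists_length_eq)

text \<open>Entries never exceed their index and rise by at most 1 per step, so reaching
  \<open>j\<close> at position \<open>j\<close> requires a rise at every step.\<close>

lemma staircase_forced_below:
  assumes "s \<in> staircase_words n" "j < n" "s ! j = j" "i \<le> j"
  shows "s ! i = i"
  using assms(4)
proof (induction rule: inc_induct)
  case base
  show ?case by fact
next
  case (step m)
  then show ?case
    using staircase_step[OF assms(1), of m] staircase_nth_le[OF assms(1), of m] assms(2) by simp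
qed

text \<open>Test word for comparisons at \<open>k\<close>. The ramp is the largest staircase prefix,
  so from the left it constrains \<open>v\<close> only by \<open>v \<le> k\<close>.\<close>

definition ramp_update :: "nat \<Rightarrow> nat \<Rightarrow> nat list \<Rightarrow> nat list" where
  "ramp_update k v s = [0..<k] @ v # drop (Suc k) s"

lemma nth_ramp_update:
  "k < length s \<Longrightarrow> i < length s \<Longrightarrow>
     ramp_update k v s ! i = (if i < k then i else if i = k then v else s ! i)"
  by (auto simp: ramp_update_def nth_append nth_Cons')

lemma ramp_update_staircase:
  assumes "s \<in> staircase_words n" "k < n" "v \<le> k" "Suc k < n \<Longrightarrow> s ! Suc k \<le> v + 1"
  shows "ramp_update k v s \<in> staircase_words n"
proof -
  have len: "length s = n" by (rule staircase_length) fact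
  have "length (ramp_update k v s) = n" using assms(2) len by (simp add: ramp_update_def)
  moreover have "ramp_update k v s ! Suc i \<le> ramp_update k v s ! i + 1" if "Suc i < n" for i
    using that assms staircase_step[OF assms(1), of i] by (auto simp: nth_ramp_update len)
  moreover have "ramp_update k v s ! 0 = 0"
    using assms(2,3) by (auto simp: nth_ramp_update len)
  ultimately show ?thesis by (simp add: staircase_words_def)
qed

section \<open>Extreme words with a given suffix\<close>

text \<open>
  The flag is \<open>True\<close> for the last and \<open>False\<close> for the first word among those that agree with \<open>s\<close> from
  position \<open>k\<close> on.
\<close>

definition extreme :: "bool \<Rightarrow> nat \<Rightarrow> nat list \<Rightarrow> nat \<Rightarrow> bool" where
  "extreme b n s k \<longleftrightarrow> (\<forall>u \<in> staircase_words n. \<forall>j < k. (\<forall>i. j < i \<and> i < n \<longrightarrow> u ! i = s ! i) \<longrightarrow>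
     (if odd (tail_weight s (Suc j)) = b then u ! j \<le> s ! j else s ! j \<le> u ! j))"

lemma extreme_mono: "extreme b n s k \<Longrightarrow> j \<le> k \<Longrightarrow> extreme b n s j"
  unfolding extreme_def by (meson less_le_trans)

text \<open>Larger entries come later at odd weight and earlier at even weight, so a parity equal to
  the flag asks for the largest entry at \<open>k - 1\<close>. The test word shows that this is
  \<open>k - 1\<close>, which forces the ramp below.\<close>

lemma extreme_max:
  assumes s: "s \<in> staircase_words n" and "k < n" and ext: "extreme b n s k"
    and "odd (tail_weight s k) = b" and "i < k"
  shows "s ! i = i"
proof -
  obtain j where k: "k = Suc j" using assms(5) by (cases k) auto
  have len: "length s = n" by (rule staircase_length) fact
  let ?u = "ramp_update j j s"
  have "?u \<in> staircase_words n"
    using s staircase_nth_le[OF s, of k] assms(2) k by (intro ramp_update_staircase) auto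
  moreover have "\<forall>i. j < i \<and> i < n \<longrightarrow> ?u ! i = s ! i"
    using assms(2) k len by (auto simp: nth_ramp_update)
  ultimately have "?u ! j \<le> s ! j"
    using ext assms(4) k unfolding extreme_def by auto
  then have "s ! j = j"
    using staircase_nth_le[OF s, of j] assms(2) k len by (simp add: nth_ramp_update)
  then show ?thesis
    using staircase_forced_below[OF s, of j i] assms(2,5) k by simp
qed

text \<open>The opposite parity asks for the smallest entry, bounded below only by the step to
  \<open>Suc j\<close>. Truncated subtraction gives 0 when \<open>s ! Suc j\<close> is 0.\<close>

lemma extreme_min:
  assumes s: "s \<in> staircase_words n" and "Suc j < n" and ext: "extreme b n s (Suc j)"
    and "odd (tail_weight s (Suc j)) \<noteq> b"
  shows "s ! j = s ! Suc j - 1"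
proof -
  have len: "length s = n" by (rule staircase_length) fact
  let ?u = "ramp_update j (s ! Suc j - 1) s"
  have "?u \<in> staircase_words n"
    using s staircase_nth_le[OF s, of "Suc j"] assms(2) by (intro ramp_update_staircase) auto
  moreover have "\<forall>i. j < i \<and> i < n \<longrightarrow> ?u ! i = s ! i"
    using assms(2) len by (auto simp: nth_ramp_update)
  ultimately have "s ! j \<le> ?u ! j"
    using ext assms(4) unfolding extreme_def by auto
  then show ?thesis
    using staircase_step[OF s, of j] assms(2) len by (simp add: nth_ramp_update)
qed

definition extreme_entry :: "nat \<Rightarrow> nat \<Rightarrow> nat \<Rightarrow> nat" where
  "extreme_entry k m i =
     (if Suc i = k then m else if Suc (Suc i) = k \<and> odd m then m - 1 else i)"

text \<open>The minimum \<open>m\<close> at \<open>k - 1\<close> adds \<open>m + 1\<close> to the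
  weight. For even \<open>m\<close> the parity flips and \<open>extreme_max\<close> applies; for odd
  \<open>m\<close> it stays, and a second minimum \<open>m - 1\<close> follows, whose evenness flips
  it.\<close>

lemma extreme_min_entries:
  assumes s: "s \<in> staircase_words n" and k: "k < n" and ext: "extreme b n s k"
    and par: "odd (tail_weight s k) \<noteq> b" and i: "i < k"
  shows "s ! i = extreme_entry k (s ! k - 1) i"
proof -
  obtain j where j: "k = Suc j" using i by (cases k) auto
  define m where "m = s ! k - 1"
  have len: "length s = n" by (rule staircase_length) fact
  have sj: "s ! j = m"
    using extreme_min[OF s, of j b] k ext par j by (simp add: m_def)
  have wj: "tail_weight s j = m + 1 + tail_weight s k"
    using tail_weight_Suc[of j s] k j len sj by simp
  show ?thesis
  proof (cases "i = j")
    case True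
    then show ?thesis using sj j by (simp add: extreme_entry_def m_def)
  next
    case False
    then have ij: "i < j" using i j by simp
    have extj: "extreme b n s j" by (rule extreme_mono[OF ext]) (simp add: j)
    show ?thesis
    proof (cases "odd m")
      case False
      then have "s ! i = i"
        using extreme_max[OF s _ extj _ ij] wj par k j by auto
      then show ?thesis using False ij j by (simp add: extreme_entry_def m_def)
    next
      case True
      obtain l where l: "j = Suc l" using ij by (cases j) auto
      have sl: "s ! l = m - 1"
        using extreme_min[OF s, of l b] extj wj par True k j l sj by auto
      \<comment> \<open>An odd \<open>m\<close> is positive, so \<open>m - 1 + 1\<close> is
        \<open>m\<close> despite truncation.\<close>
      have wl: "tail_weight s l = m + tail_weight s j"
        using tail_weight_Suc[of l s] k j l len sl odd_pos[OF True] by simp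
      have extl: "extreme b n s l" by (rule extreme_mono[OF extj]) (simp add: l)
      show ?thesis
      proof (cases "i = l")
        case eq: True
        then show ?thesis using sl True j l by (simp add: extreme_entry_def m_def)
      next
        case False
        then have il: "i < l" using ij l by simp
        have "s ! i = i"
          using extreme_max[OF s _ extl _ il] wj wl par True k j l by auto
        then show ?thesis using il j l by (simp add: extreme_entry_def)
      qed
    qed
  qed
qed

section \<open>Consecutive words\<close>

locale consecutive_words =
  fixes n :: nat and s t :: "nat list" and k :: nat
  assumes s: "s \<in> staircase_words n" and t: "t \<in> staircase_words n"
    and less: "less_at k s t"
    and no_between: "\<And>u. u \<in> staircase_words n \<Longrightarrow> coreflected_less s u \<Longrightarrow> \<not> coreflected_less u t"
begin

lemma lengths: "length s = n" "length t = n"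
  using s t by (auto simp: staircase_length)

lemma k_less: "k < n"
  using less lengths by (simp add: less_at_def)

lemma above: "k < i \<Longrightarrow> i < n \<Longrightarrow> s ! i = t ! i"
  using less lengths by (simp add: less_at_def)

lemma weight_eq: "tail_weight s (Suc k) = tail_weight t (Suc k)"
  using less by (rule less_at_tail_weight)

text \<open>Otherwise \<open>ramp_update k v s\<close> would lie between \<open>s\<close> and
  \<open>t\<close>. The value \<open>v\<close> is admissible because it exceeds the smaller of the
  two entries at \<open>k\<close>, which already admits the shared entry at
  \<open>Suc k\<close>.\<close>

lemma not_strictly_between:
  assumes "s ! k < v \<and> v < t ! k \<or> t ! k < v \<and> v < s ! k"
  shows False
proof -
  let ?u = "ramp_update k v s"
  have u: "?u \<in> staircase_words n"
  proof (rule ramp_update_staircase[OF s k_less])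
    show "v \<le> k"
      using assms staircase_nth_le[OF s k_less] staircase_nth_le[OF t k_less] by auto
    show "s ! Suc k \<le> v + 1" if "Suc k < n"
      using assms staircase_step[OF s that] staircase_step[OF t that] above[of "Suc k"] that by auto
  qed
  have nth: "?u ! i = (if i < k then i else if i = k then v else s ! i)" if "i < n" for i
    using nth_ramp_update that k_less lengths by simp
  have len: "length ?u = n" using u by (rule staircase_length)
  have "tail_weight ?u (Suc k) = tail_weight s (Suc k)"
    using len lengths nth by (intro tail_weight_cong) auto
  then have "less_at k s ?u" "less_at k ?u t"
    using assms less len lengths k_less nth above by (auto simp: less_at_def split: if_splits)
  then show False using no_between[OF u] by (auto simp: coreflected_less_iff)
qed

lemma differ_by_one: "s ! k = t ! k + 1 \<or> t ! k = s ! k + 1"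
proof -
  have "s ! k \<noteq> t ! k" using less by (auto simp: less_at_def split: if_splits)
  then show ?thesis
    using not_strictly_between[of "s ! k + 1"] not_strictly_between[of "t ! k + 1"] by presburger
qed

text \<open>The flags are \<open>True\<close> for \<open>s\<close> and \<open>False\<close> for
  \<open>t\<close>, so opposite parities make both words obey the same rule.\<close>

lemma weight_parity: "odd (tail_weight s k) \<longleftrightarrow> even (tail_weight t k)"
  using differ_by_one weight_eq tail_weight_Suc[of k s] tail_weight_Suc[of k t] k_less lengths
  by auto

text \<open>A word agreeing with \<open>s\<close> to the right of some \<open>j < k\<close> still
  precedes \<open>t\<close> at \<open>k\<close>, so it cannot come after \<open>s\<close>.\<close>

lemma extreme_left: "extreme True n s k"
  unfolding extreme_def
proof (intro ballI allI impI)
  fix u j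
  assume u: "u \<in> staircase_words n" and j: "j < k"
    and agree: "\<forall>i. j < i \<and> i < n \<longrightarrow> u ! i = s ! i"
  have len: "length u = n" using u by (rule staircase_length)
  have "tail_weight u (Suc k) = tail_weight s (Suc k)"
    using len lengths agree j by (intro tail_weight_cong) auto
  then have "less_at k u t"
    using less agree j k_less len lengths by (auto simp: less_at_def)
  then have "\<not> less_at j s u"
    using no_between[OF u] by (auto simp: coreflected_less_iff)
  then show "if odd (tail_weight s (Suc j)) = True then u ! j \<le> s ! j else s ! j \<le> u ! j"
    using agree len lengths j k_less by (auto simp: less_at_def split: if_splits)
qed

lemma extreme_right: "extreme False n t k"
  unfolding extreme_def
proof (intro ballI allI impI)
  fix u j
  assume u: "u \<in> staircase_words n" and j: "j < k"
    and agree: "\<forall>i. j < i \<and> i < n \<longrightarrow> u ! i = t ! i"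
  have len: "length u = n" using u by (rule staircase_length)
  have w: "tail_weight u (Suc j) = tail_weight t (Suc j)"
    using len lengths agree by (intro tail_weight_cong) auto
  have "less_at k s u"
    using less agree j k_less len lengths by (auto simp: less_at_def)
  then have "\<not> less_at j u t"
    using no_between[OF u] by (auto simp: coreflected_less_iff)
  then show "if odd (tail_weight t (Suc j)) = False then u ! j \<le> t ! j else t ! j \<le> u ! j"
    using agree len lengths j k_less w by (auto simp: less_at_def split: if_splits)
qed

text \<open>To the left of \<open>k\<close> both words are ramps or both follow
  \<open>extreme_entry\<close>, so only \<open>k - 1\<close> and \<open>k - 2\<close> can differ. A
  difference at \<open>k - 2\<close> occurs only together with one at \<open>k - 1\<close>, so no
  gap arises.\<close>

lemma diff_positions_interval: "\<exists>a. diff_positions s t = {a..<Suc k} \<and> Suc k \<le> a + 3"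
proof -
  have diff: "diff_positions s t = insert k {i. i < k \<and> s ! i \<noteq> t ! i}"
  proof -
    have "i < n \<and> s ! i \<noteq> t ! i \<longleftrightarrow> i = k \<or> i < k \<and> s ! i \<noteq> t ! i" for i
      using above[of i] k_less differ_by_one by (cases i k rule: linorder_cases) auto
    then show ?thesis unfolding diff_positions_def lengths by blast
  qed
  have top: "diff_positions s t = {k..<Suc k}" if "\<And>i. i < k \<Longrightarrow> s ! i = t ! i"
    using that diff by auto
  show ?thesis
  proof (cases "odd (tail_weight s k)")
    case True
    then have "s ! i = t ! i" if "i < k" for i
      using extreme_max[OF s k_less extreme_left _ that] extreme_max[OF t k_less extreme_right _ that]
        weight_parity by simp
    then show ?thesis using top by (intro exI[of _ k]) simp
  next
    case False
    \<comment> \<open>By truncation, \<open>x\<close> and \<open>y\<close> coincide when the entries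
      at \<open>k\<close> are 0 and 1; otherwise they are consecutive numbers.\<close>
    define x y where "x = s ! k - 1" and "y = t ! k - 1"
    have sx: "s ! i = extreme_entry k x i" and ty: "t ! i = extreme_entry k y i" if "i < k" for i
      using extreme_min_entries[OF s k_less extreme_left _ that]
        extreme_min_entries[OF t k_less extreme_right _ that] weight_parity False
      by (simp_all add: x_def y_def)
    show ?thesis
    proof (cases "x = y")
      case True
      then show ?thesis using top sx ty by (intro exI[of _ k]) simp
    next
      case neq: False
      show ?thesis
      proof (cases "k \<ge> 2 \<and> s ! (k - 2) \<noteq> t ! (k - 2)")
        case True
        then obtain l where k: "k = Suc (Suc l)" by (metis add_2_eq_Suc le_Suc_ex)
        have "s ! l \<noteq> t ! l" using True k by simp
        moreover have "s ! Suc l \<noteq> t ! Suc l"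
          using sx[of "Suc l"] ty[of "Suc l"] neq k by (simp add: extreme_entry_def)
        moreover have "s ! i = t ! i" if "i < l" for i
          using sx[of i] ty[of i] that k by (simp add: extreme_entry_def)
        ultimately have "{i. i < k \<and> s ! i \<noteq> t ! i} = {l, Suc l}"
          unfolding k less_Suc_eq by blast
        then have "diff_positions s t = {l..<Suc k}"
          by (simp add: diff k atLeastLessThanSuc insert_commute)
        then show ?thesis using k by (intro exI[of _ l]) simp
      next
        case same: False
        have "s ! i \<noteq> t ! i \<longleftrightarrow> Suc i = k" if "i < k" for i
        proof -
          have "s ! i = t ! i" if "Suc (Suc i) = k"
            using same that by auto
          then show ?thesis
            using sx[OF that] ty[OF that] neq by (auto simp: extreme_entry_def split: if_splits)
        qed
        then have "{i. i < k \<and> s ! i \<noteq> t ! i} = {i. Suc i = k}"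
          by blast
        \<comment> \<open>This covers \<open>k = 0\<close> too, where truncation makes both sides
          \<open>{0}\<close>.\<close>
        moreover have "insert k {i. Suc i = k} = {k - 1..<Suc k}"
          by auto
        ultimately have "diff_positions s t = {k - 1..<Suc k}"
          by (simp only: diff)
        then show ?thesis by (intro exI[of _ "k - 1"]) auto
      qed
    qed
  qed
qed

end

text \<open>Unique existence ensures that the claim about every \<open>L\<close> is not vacuous and
  concerns one definite listing.\<close>

theorem theorem4:
  fixes n :: nat
  assumes "n \<ge> 1"
  shows "(\<exists>!L. listed_in_order coreflected_less (staircase_words n) L) \<and>
         (\<forall>L. listed_in_order coreflected_less (staircase_words n) L \<longrightarrow> adjacent_gray_code 3 L)"
proof (intro conjI allI impI)
  have "totalp_on (staircase_words n) coreflected_less"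
    by (rule totalp_onI) (simp add: coreflected_less_total staircase_length)
  then have "\<exists>L. listed_in_order coreflected_less (staircase_words n) L"
    by (intro listed_in_order_exists finite_staircase_words
        transp_on_subset[OF transp_coreflected_less subset_UNIV])
  moreover have "L = L'" if "listed_in_order coreflected_less (staircase_words n) L"
    "listed_in_order coreflected_less (staircase_words n) L'" for L L'
    using that unfolding listed_in_order_def
    by (intro sorted_wrt_set_unique[OF asymp_coreflected_less]) auto
  ultimately show "\<exists>!L. listed_in_order coreflected_less (staircase_words n) L"
    by blast
  fix L
  assume L: "listed_in_order coreflected_less (staircase_words n) L"
  then have set: "set L = staircase_words n" and sorted: "sorted_wrt coreflected_less L"
    by (auto simp: listed_in_order_def)
  show "adjacent_gray_code 3 L"
    unfolding adjacent_gray_code_def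
  proof (intro allI impI)
    fix j
    assume j: "Suc j < length L"
    have "coreflected_less (L ! j) (L ! Suc j)"
      using sorted j by (simp add: sorted_wrt_iff_nth_less)
    then obtain k where "less_at k (L ! j) (L ! Suc j)" by (auto simp: coreflected_less_iff)
    \<comment> \<open>Since \<open>L\<close> contains every staircase word, having no list entry
      between neighbours means having no such word at all between them.\<close>
    then interpret consecutive_words n "L ! j" "L ! Suc j" k
      using sorted_wrt_no_element_between[OF asymp_coreflected_less sorted j] j
      by unfold_locales (simp_all flip: set)
    show "hamming_dist (L ! j) (L ! Suc j) \<le> 3 \<and>
        (\<exists>a b. diff_positions (L ! j) (L ! Suc j) = {a..<b})"
      using diff_positions_interval by (auto simp: hamming_dist_def)
  qed
qed

end
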